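(* Let $n\ge 2$ and let $T_n$ be a random recursive tree on $[n]$. Let $v_1v_2$ be a uniformly chosen edge of $T_n$ (with $v_1<v_2$), and let $T_n^{(v_1)}$ be the subtree of $T_n$ rooted at $v_1$, i.e. the tree removed by a degree-biased cut of $T_n$. The distribution of its number of vertices $|T_n^{(v_1)}|$ is given, for positive integers $k$, by \[\mathbf{P}\left(|T_n^{(v_1)}|=k\right)=\frac{nH_{k-1}}{(n-1)(k+1)k}\mathbf{1}_{[2\le k<n]}+\frac{H_{n-1}}{n-1}\mathbf{1}_{[k=n]}.\]
   Context: An increasing tree on $[n]=\{1,\dots,n\}$ is a rooted labeled tree with vertex set $[n]$ in which labels along any path away from the root increase (so the root is $1$). A random recursive tree $T_n$ is a uniformly random element of the set of increasing trees on $[n]$. An edge is written $v_1v_2$ with $v_1<v_2$, so $v_1$ is the parent of $v_2$. The subtree $T_n^{(v)}$ rooted at $v$ consists of $v$ and all its descendants. A degree-biased cut chooses an edge $v_1v_2$ of $T_n$ uniformly at random and deletes $T_n^{(v_1)}$. $H_m=\sum_{i=1}^m i^{-1}$ is the $m$-th harmonic number ($H_0=0$). *)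

theory Defs
  imports "HOL-Probability.Probability"
begin

text \<open>Finite simple graphs are given by a vertex set \<open>V\<close> and a set \<open>E\<close> of two-element
  subsets of \<open>V\<close>.\<close>

definition simple_graph :: "'a set \<Rightarrow> 'a set set \<Rightarrow> bool" where
  "simple_graph V E \<longleftrightarrow> finite V \<and> (\<forall>e\<in>E. e \<subseteq> V \<and> card e = 2)"

definition is_path :: "'a set \<Rightarrow> 'a set set \<Rightarrow> 'a list \<Rightarrow> bool" where
  "is_path V E p \<longleftrightarrow> p \<noteq> [] \<and> set p \<subseteq> V \<and> distinct p \<and> successively (\<lambda>x y. {x, y} \<in> E) p"

definition is_cycle :: "'a set \<Rightarrow> 'a set set \<Rightarrow> 'a list \<Rightarrow> bool" where
  "is_cycle V E c \<longleftrightarrow> is_path V E c \<and> length c \<ge> 3 \<and> {last c, hd c} \<in> E"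

definition is_tree :: "'a set \<Rightarrow> 'a set set \<Rightarrow> bool" where
  "is_tree V E \<longleftrightarrow> simple_graph V E \<and> V \<noteq> {} \<and>
     (\<forall>u\<in>V. \<forall>v\<in>V. \<exists>p. is_path V E p \<and> hd p = u \<and> last p = v) \<and>
     (\<nexists>c. is_cycle V E c)"

text \<open>A rooted tree on \<open>V\<close> is a pair of a root and an edge set. Every path directed away from the
  root is a segment of a path starting at the root, so it suffices to look at the latter.\<close>

definition increasing_trees :: "nat \<Rightarrow> (nat \<times> nat set set) set" where
  "increasing_trees n = {(r, E). is_tree {1..n} E \<and> r \<in> {1..n} \<and>
     (\<forall>p. is_path {1..n} E p \<and> hd p = r \<longrightarrow> sorted_wrt (<) p)}"

text \<open>The vertex set of the subtree rooted at \<open>v\<close>: those \<open>w\<close> for which \<open>v\<close> lies on the path from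
  the root \<open>r\<close> to \<open>w\<close> (so \<open>v\<close> itself is included).\<close>

definition subtree_vertices :: "'a set \<Rightarrow> 'a \<times> 'a set set \<Rightarrow> 'a \<Rightarrow> 'a set" where
  "subtree_vertices V = (\<lambda>(r, E) v.
     {w \<in> V. \<exists>p. is_path V E p \<and> hd p = r \<and> last p = w \<and> v \<in> set p})"

definition random_recursive_tree :: "nat \<Rightarrow> (nat \<times> nat set set) pmf" where
  "random_recursive_tree n = pmf_of_set (increasing_trees n)"

text \<open>The joint law of a random recursive tree \<open>T\<close> and an edge chosen uniformly from \<open>T\<close>. An edge
  \<open>v\<^sub>1v\<^sub>2\<close> with \<open>v\<^sub>1 < v\<^sub>2\<close> is the set \<open>{v\<^sub>1, v\<^sub>2}\<close>, so \<open>v\<^sub>1\<close> is its minimum.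
  For \<open>n = 1\<close> the tree has no edge and the law is meaningless.\<close>

definition random_tree_and_edge :: "nat \<Rightarrow> ((nat \<times> nat set set) \<times> nat set) pmf" where
  "random_tree_and_edge n = do {
     T \<leftarrow> random_recursive_tree n;
     e \<leftarrow> pmf_of_set (snd T);
     return_pmf (T, e)
   }"

definition removed_subtree_size :: "nat \<Rightarrow> (nat \<times> nat set set) \<times> nat set \<Rightarrow> nat" where
  "removed_subtree_size n = (\<lambda>(T, e). card (subtree_vertices {1..n} T (Min e)))"

end

theory Submission
  imports Defs
begin

text \<open>
  The largest label \<open>n + 1\<close> of an increasing tree is a leaf, and deleting it leaves an increasing
  tree on \<open>[n]\<close>; conversely, \<open>n + 1\<close> may be attached to any \<open>u \<in> [n]\<close>. So the increasing trees on
  \<open>[n + 1]\<close> correspond to the pairs \<open>(T, u)\<close> (\<open>increasing_trees_Suc\<close>, \<open>inj_on_attach_leaf\<close>), there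
  are \<open>(n - 1)!\<close> of them on \<open>[n]\<close>, and the law can be found by following two counts through this
  growth step.

  Let \<open>B\<^sub>n(k)\<close> be the number of pairs of a tree \<open>T\<close> on \<open>[n]\<close> and a vertex \<open>v\<close> whose subtree has \<open>k\<close>
  vertices, and let \<open>S\<^sub>n(k)\<close> be the number of pairs of a tree and an edge for which the subtree of
  the parent end has \<open>k\<close> vertices. Attaching \<open>n + 1\<close> to \<open>u\<close> enlarges the subtree of \<open>v\<close> by one vertex
  if \<open>u\<close> lies in it, and leaves it alone otherwise. A subtree of size \<open>k\<close> therefore keeps its size
  for \<open>n - k\<close> choices of \<open>u\<close> and grows for \<open>k\<close> choices. In addition there is a new vertex, with
  subtree of size \<open>1\<close>, and a new edge, whose parent end \<open>u\<close> now has a subtree one larger than before.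
  This gives
    \<open>B\<^sub>n\<^sub>+\<^sub>1(j + 1) = (n - j - 1) B\<^sub>n(j + 1) + j B\<^sub>n(j) + n! [j = 0]\<close>,
    \<open>S\<^sub>n\<^sub>+\<^sub>1(j + 1) = (n - j - 1) S\<^sub>n(j + 1) + j S\<^sub>n(j) + B\<^sub>n(j)\<close>.
  By induction, \<open>B\<^sub>n(k) / (n - 1)!\<close> is \<open>n / (k (k + 1))\<close> for \<open>0 < k < n\<close> and \<open>1\<close> for \<open>k = n\<close>, while
  \<open>S\<^sub>n(k) / (n - 1)!\<close> is \<open>n H\<^sub>k\<^sub>-\<^sub>1 / (k (k + 1))\<close> for \<open>0 < k < n\<close> and \<open>H\<^sub>n\<^sub>-\<^sub>1\<close> for \<open>k = n\<close>
  (\<open>vertices_of_subtree_size_eq\<close>, \<open>edges_of_subtree_size_eq\<close>). Every tree on \<open>[n]\<close> has \<open>n - 1\<close> edges,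
  so the pair of tree and edge is uniform and the probability is \<open>S\<^sub>n(k) / ((n - 1) (n - 1)!)\<close>.
\<close>

section \<open>Attaching a leaf to a graph\<close>

lemma is_path_snoc:
  "is_path V E (q @ [x]) \<longleftrightarrow>
     x \<in> V \<and> (q = [] \<or> is_path V E q \<and> x \<notin> set q \<and> {last q, x} \<in> E)"
  by (auto simp: is_path_def successively_append_iff)

lemma is_path_rev: "is_path V E (rev p) \<longleftrightarrow> is_path V E p"
  by (simp add: is_path_def insert_commute)

lemma is_cycle_rev: "is_cycle V E (rev c) \<longleftrightarrow> is_cycle V E c"
  by (auto simp: is_cycle_def is_path_rev hd_rev last_rev insert_commute)

lemma is_path_mono:
  "is_path V E p \<Longrightarrow> V \<subseteq> V' \<Longrightarrow> E \<subseteq> E' \<Longrightarrow> is_path V' E' p"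
  unfolding is_path_def by (auto elim: successively_mono)

text \<open>A path has at most two edges at each interior vertex, going to different neighbours. The new
  leaf \<open>w\<close> has a single neighbour, so a path that does not start at \<open>w\<close> can only visit it at its end.\<close>

lemma is_path_attach_leaf:
  assumes E: "\<forall>e\<in>E. e \<subseteq> V" and w: "w \<notin> V" and u: "u \<in> V"
  shows "is_path (insert w V) (insert {u, w} E) p \<and> hd p \<noteq> w \<longleftrightarrow>
    is_path V E p \<or> (\<exists>q. p = q @ [w] \<and> is_path V E q \<and> last q = u)"
    (is "?L p \<longleftrightarrow> ?R p")
proof
  show "?R p" if "?L p"
    using that
  proof (induction p rule: rev_induct)
    case Nil
    then show ?case by (simp add: is_path_def)
  next
    case (snoc x q)
    show ?case
    proof (cases "q = []")
      case True
      with snoc.prems have "x \<in> V" by (auto simp: is_path_def)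
      with True show ?thesis by (simp add: is_path_def)
    next
      case False
      with snoc.prems have q: "is_path (insert w V) (insert {u, w} E) q" "hd q \<noteq> w"
        and x: "x \<in> insert w V" "x \<notin> set q" "{last q, x} \<in> insert {u, w} E"
        by (auto simp: is_path_snoc)
      from snoc.IH q consider "is_path V E q"
        | q' where "q = q' @ [w]" "is_path V E q'" "last q' = u" by blast
      then show ?thesis
      proof cases
        case 1
        then have "last q \<in> V" using False by (auto simp: is_path_def)
        with 1 x E w False show ?thesis
          by (cases "x = w") (auto simp: is_path_snoc doubleton_eq_iff)
      next
        case 2
        then have "{w, x} \<in> insert {u, w} E" "x \<noteq> w" using x by auto
        then have "x = u" using E w by (auto simp: doubleton_eq_iff)
        moreover have "u \<in> set q" using 2 by (auto simp: is_path_def)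
        ultimately show ?thesis using x by blast
      qed
    qed
  qed
next
  assume "?R p"
  then show "?L p"
  proof (elim disjE exE conjE)
    assume p: "is_path V E p"
    then have "hd p \<in> V" by (auto simp: is_path_def)
    then show ?thesis using w is_path_mono[OF p, of "insert w V" "insert {u, w} E"] by auto
  next
    fix q assume q: "p = q @ [w]" "is_path V E q" "last q = u"
    then have "hd q \<in> V" "w \<notin> set q" "q \<noteq> []" using w by (auto simp: is_path_def)
    then show ?thesis using w q is_path_mono[OF q(2), of "insert w V" "insert {u, w} E"]
      by (auto simp: is_path_snoc)
  qed
qed

lemma is_path_attach_leaf_old_end:
  assumes "\<forall>e\<in>E. e \<subseteq> V" and "w \<notin> V" and "u \<in> V"
    and "hd p \<noteq> w" and "last p \<noteq> w"
  shows "is_path (insert w V) (insert {u, w} E) p \<longleftrightarrow> is_path V E p"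
  using is_path_attach_leaf[OF assms(1-3), of p] assms(4,5) by auto

text \<open>A cycle that does not start at \<open>w\<close> either avoids \<open>w\<close> or ends there. In the second case its first
  and its last but one vertex are both neighbours of \<open>w\<close>, hence equal to \<open>u\<close>, and the cycle is too
  short. A cycle that starts at \<open>w\<close> is read backwards.\<close>

lemma is_tree_attach_leaf:
  assumes T: "is_tree V E" and w: "w \<notin> V" and u: "u \<in> V"
  shows "is_tree (insert w V) (insert {u, w} E)"
proof -
  let ?V = "insert w V" and ?E = "insert {u, w} E"
  have E: "\<forall>e\<in>E. e \<subseteq> V" using T by (auto simp: is_tree_def simple_graph_def)
  note path = is_path_attach_leaf[OF E w u]
  have conn_V: "\<exists>p. is_path V E p \<and> hd p = a \<and> last p = b" if "a \<in> V" "b \<in> V" for a b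
    using T that unfolding is_tree_def by blast
  have old: "\<exists>p. is_path ?V ?E p \<and> hd p = a \<and> last p = b" if ab: "a \<in> V" "b \<in> V" for a b
  proof -
    obtain p where p: "is_path V E p" "hd p = a" "last p = b"
      using conn_V[OF ab] by blast
    from p(1) have "is_path ?V ?E p" by (rule is_path_mono) auto
    with p show ?thesis by blast
  qed
  have new: "\<exists>p. is_path ?V ?E p \<and> hd p = a \<and> last p = w" if a: "a \<in> V" for a
  proof -
    obtain q where q: "is_path V E q" "hd q = a" "last q = u"
      using conn_V[OF a u] by blast
    then have "is_path ?V ?E (q @ [w])" using path[of "q @ [w]"] by blast
    moreover have "hd (q @ [w]) = a" using q by (auto simp: is_path_def)
    ultimately show ?thesis by (intro exI[of _ "q @ [w]"]) simp
  qed
  have rev: "\<exists>p. is_path ?V ?E p \<and> hd p = b \<and> last p = a"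
    if ab: "\<exists>p. is_path ?V ?E p \<and> hd p = a \<and> last p = b" for a b
  proof -
    obtain p where "is_path ?V ?E p" "hd p = a" "last p = b" using ab by blast
    then show ?thesis by (intro exI[of _ "rev p"]) (simp add: is_path_rev hd_rev last_rev)
  qed
  have triv: "\<exists>p. is_path ?V ?E p \<and> hd p = w \<and> last p = w"
    by (intro exI[of _ "[w]"]) (simp add: is_path_def)
  have conn: "\<exists>p. is_path ?V ?E p \<and> hd p = a \<and> last p = b" if ab: "a \<in> ?V" "b \<in> ?V" for a b
  proof (cases "a = w"; cases "b = w")
    assume "a = w" "b = w"
    then show ?thesis using triv by simp
  next
    assume "a = w" "b \<noteq> w"
    then show ?thesis using rev[OF new, of b] ab by simp
  next
    assume "a \<noteq> w" "b = w"
    then show ?thesis using new[of a] ab by simp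
  next
    assume "a \<noteq> w" "b \<noteq> w"
    then show ?thesis using old[of a b] ab by simp
  qed
  have no_cycle: False if c: "is_cycle ?V ?E c" "hd c \<noteq> w" for c
  proof -
    have p: "is_path ?V ?E c" and len: "length c \<ge> 3" and close: "{last c, hd c} \<in> ?E"
      using c by (auto simp: is_cycle_def)
    from path[of c] p c(2) consider "is_path V E c"
      | q where "c = q @ [w]" "is_path V E q" "last q = u" by blast
    then show False
    proof cases
      case 1
      then have "last c \<in> V" "hd c \<in> V" by (auto simp: is_path_def)
      then have "{last c, hd c} \<in> E" using close w by (auto simp: doubleton_eq_iff)
      with 1 len T show False by (auto simp: is_cycle_def is_tree_def)
    next
      case 2
      then have "{w, hd q} \<in> ?E" "hd q \<in> V" using close by (auto simp: is_path_def)
      then have "hd q = last q" using E w 2 by (auto simp: doubleton_eq_iff)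
      then have "length q \<le> 1" using 2
        by (cases q) (auto simp: is_path_def split: if_splits)
      with 2 len show False by simp
    qed
  qed
  have acyc: "\<nexists>c. is_cycle ?V ?E c"
  proof
    assume "\<exists>c. is_cycle ?V ?E c"
    then obtain c where c: "is_cycle ?V ?E c" by blast
    then have "hd c = w" using no_cycle by blast
    moreover have "last c = w" using no_cycle[of "rev c"] c by (auto simp: is_cycle_rev hd_rev)
    moreover have "distinct c" "length c \<ge> 3" using c by (auto simp: is_cycle_def is_path_def)
    ultimately show False using last_in_set[of "tl c"] by (cases c) (auto split: if_splits)
  qed
  have "simple_graph ?V ?E"
    using T w u by (auto simp: is_tree_def simple_graph_def card_2_iff)
  with conn acyc show ?thesis unfolding is_tree_def by blast
qed

lemma is_tree_remove_leaf:
  assumes T: "is_tree (insert w V) (insert {u, w} E)" and E: "\<forall>e\<in>E. e \<subseteq> V"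
    and w: "w \<notin> V" and u: "u \<in> V"
  shows "is_tree V E"
proof -
  let ?V = "insert w V" and ?E = "insert {u, w} E"
  have conn: "\<exists>p. is_path V E p \<and> hd p = a \<and> last p = b" if "a \<in> V" "b \<in> V" for a b
  proof -
    obtain p where "is_path ?V ?E p" "hd p = a" "last p = b"
      using T \<open>a \<in> V\<close> \<open>b \<in> V\<close> unfolding is_tree_def by (meson insertI2)
    then show ?thesis using is_path_attach_leaf_old_end[OF E w u, of p] that w by blast
  qed
  have "is_cycle ?V ?E c" if "is_cycle V E c" for c
    using that is_path_mono[of V E c ?V ?E] by (auto simp: is_cycle_def)
  then have "\<nexists>c. is_cycle V E c" using T unfolding is_tree_def by blast
  with conn show ?thesis
    using T E u unfolding is_tree_def simple_graph_def by (auto simp: finite_insert)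
qed

text \<open>Paths from the root to old vertices do not change, and every path from the root to \<open>w\<close>
  extends one to \<open>u\<close>; hence, among the old vertices, \<open>w\<close> becomes a descendant of exactly \<open>u\<close> and
  its ancestors.\<close>

lemma subtree_vertices_attach_leaf:
  assumes E: "\<forall>e\<in>E. e \<subseteq> V" and w: "w \<notin> V" and u: "u \<in> V" and r: "r \<in> V" and v: "v \<in> V"
  shows "subtree_vertices (insert w V) (r, insert {u, w} E) v =
    subtree_vertices V (r, E) v \<union> (if u \<in> subtree_vertices V (r, E) v then {w} else {})"
proof -
  let ?V = "insert w V" and ?E = "insert {u, w} E"
  have old: "(\<exists>p. is_path ?V ?E p \<and> hd p = r \<and> last p = x \<and> v \<in> set p) \<longleftrightarrow>
      (\<exists>p. is_path V E p \<and> hd p = r \<and> last p = x \<and> v \<in> set p)" if "x \<in> V" for x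
    using is_path_attach_leaf_old_end[OF E w u] r w that by metis
  have new: "(\<exists>p. is_path ?V ?E p \<and> hd p = r \<and> last p = w \<and> v \<in> set p) \<longleftrightarrow>
      (\<exists>q. is_path V E q \<and> hd q = r \<and> last q = u \<and> v \<in> set q)" (is "?A \<longleftrightarrow> ?B")
  proof
    assume ?A
    then obtain p where p: "is_path ?V ?E p" "hd p = r" "last p = w" "v \<in> set p" by blast
    have "\<not> is_path V E p" using last_in_set[of p] p w by (auto simp: is_path_def)
    moreover have "hd p \<noteq> w" using p r w by blast
    ultimately obtain q where q: "p = q @ [w]" "is_path V E q" "last q = u"
      using is_path_attach_leaf[OF E w u, of p] p(1) by blast
    then have "q \<noteq> []" by (auto simp: is_path_def)
    then show ?B using p q v w by auto
  next
    assume ?B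
    then obtain q where q: "is_path V E q" "hd q = r" "last q = u" "v \<in> set q" by blast
    then have "q \<noteq> []" by (auto simp: is_path_def)
    moreover have "is_path ?V ?E (q @ [w])" using is_path_attach_leaf[OF E w u, of "q @ [w]"] q
      by blast
    ultimately show ?A using q by (intro exI[of _ "q @ [w]"]) auto
  qed
  show ?thesis
    using old new u by (auto simp: subtree_vertices_def)
qed

lemma subtree_vertices_new_leaf:
  assumes T: "is_tree V E" and w: "w \<notin> V" and u: "u \<in> V" and r: "r \<in> V"
  shows "subtree_vertices (insert w V) (r, insert {u, w} E) w = {w}"
proof -
  let ?V = "insert w V" and ?E = "insert {u, w} E"
  have E: "\<forall>e\<in>E. e \<subseteq> V" using T by (auto simp: is_tree_def simple_graph_def)
  have "x = w" if p: "is_path ?V ?E p" "hd p = r" "last p = x" "w \<in> set p" for p x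
  proof -
    have "w \<notin> set p" if "is_path V E p" using that w by (auto simp: is_path_def)
    then show ?thesis using is_path_attach_leaf[OF E w u, of p] p r w by auto
  qed
  moreover have "\<exists>p. is_path ?V ?E p \<and> hd p = r \<and> last p = w \<and> w \<in> set p"
  proof -
    obtain p where "is_path ?V ?E p" "hd p = r" "last p = w"
      using is_tree_attach_leaf[OF T w u] r unfolding is_tree_def by blast
    moreover from this have "w \<in> set p" using last_in_set[of p] by (auto simp: is_path_def)
    ultimately show ?thesis by blast
  qed
  ultimately show ?thesis by (auto simp: subtree_vertices_def)
qed

lemma self_in_subtree_vertices:
  assumes "is_tree V E" "r \<in> V" "v \<in> V"
  shows "v \<in> subtree_vertices V (r, E) v"
proof -
  obtain p where p: "is_path V E p" "hd p = r" "last p = v"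
    using assms unfolding is_tree_def by blast
  then have "v \<in> set p" using last_in_set[of p] by (auto simp: is_path_def)
  with p assms show ?thesis by (auto simp: subtree_vertices_def)
qed

section \<open>Growing increasing trees\<close>

definition attach_leaf :: "'a \<Rightarrow> 'a \<times> 'a set set \<Rightarrow> 'a \<Rightarrow> 'a \<times> 'a set set" where
  "attach_leaf w T u = (fst T, insert {u, w} (snd T))"

lemma increasing_treesD:
  assumes "T \<in> increasing_trees n"
  shows "is_tree {1..n} (snd T)" "fst T \<in> {1..n}" "\<forall>e\<in>snd T. e \<subseteq> {1..n} \<and> card e = 2"
  using assms by (auto simp: increasing_trees_def is_tree_def simple_graph_def)

lemma atLeastAtMost_Suc_insert: "{1..Suc n} = insert (Suc n) {1..n}"
  by auto

lemma increasing_trees_1: "increasing_trees 1 = {(1, {})}"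
proof -
  have len: "length p \<le> 1" if "is_path {1..1::nat} E p" for E p
  proof -
    from that have "card (set p) \<le> card {1::nat}"
      by (intro card_mono) (auto simp: is_path_def)
    with that show ?thesis by (simp add: is_path_def distinct_card)
  qed
  have "E = {}" if "is_tree {1..1::nat} E" for E
  proof -
    have "card e \<le> card {1::nat}" if "e \<in> E" for e
      using that \<open>is_tree _ E\<close> by (intro card_mono) (auto simp: is_tree_def simple_graph_def)
    with that show ?thesis by (force simp: is_tree_def simple_graph_def)
  qed
  moreover have "is_tree {1..1::nat} {}"
  proof -
    have "is_path {1..1::nat} {} [1]" by (simp add: is_path_def)
    then have "\<exists>p. is_path {1..1::nat} {} p \<and> hd p = u \<and> last p = v"
      if "u \<in> {1..1}" "v \<in> {1..1}" for u v
      using that by (intro exI[of _ "[1]"]) auto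
    moreover have "\<not> is_cycle {1..1::nat} {} c" for c
      using len[of "{}" c] by (auto simp: is_cycle_def)
    ultimately show ?thesis by (auto simp: is_tree_def simple_graph_def)
  qed
  moreover have "sorted_wrt (<) p" if "is_path {1..1::nat} E p" for E p
    using len[OF that] by (cases p) auto
  ultimately show ?thesis by (auto simp: increasing_trees_def)
qed

lemma attach_leaf_increasing:
  assumes T: "T \<in> increasing_trees n" and u: "u \<in> {1..n}"
  shows "attach_leaf (Suc n) T u \<in> increasing_trees (Suc n)"
proof -
  obtain r E where rE: "T = (r, E)" by (cases T)
  note D = increasing_treesD[OF T, unfolded rE, simplified]
  have E: "\<forall>e\<in>E. e \<subseteq> {1..n}" using D by auto
  have w: "Suc n \<notin> {1..n}" by simp
  have srt: "sorted_wrt (<) p" if "is_path {1..n} E p" "hd p = r" for p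
    using T that by (auto simp: rE increasing_trees_def)
  have "sorted_wrt (<) p"
    if p: "is_path (insert (Suc n) {1..n}) (insert {u, Suc n} E) p" "hd p = r" for p
  proof -
    have "hd p \<noteq> Suc n" using p D by auto
    then consider "is_path {1..n} E p"
      | q where "p = q @ [Suc n]" "is_path {1..n} E q"
      using is_path_attach_leaf[OF E w u, of p] p by blast
    then show ?thesis
    proof cases
      case 1
      then show ?thesis using srt p by blast
    next
      case 2
      then have "sorted_wrt (<) q" using srt[of q] p by (auto simp: is_path_def)
      with 2 show ?thesis by (auto simp: sorted_wrt_append is_path_def)
    qed
  qed
  moreover have "is_tree (insert (Suc n) {1..n}) (insert {u, Suc n} E)"
    using is_tree_attach_leaf[OF _ w u, of E] D(1) by simp
  moreover have "r \<in> insert (Suc n) {1..n}" using D(2) by simp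
  ultimately show ?thesis
    unfolding increasing_trees_def attach_leaf_def rE atLeastAtMost_Suc_insert
    by simp
qed

text \<open>The largest label is a leaf. Suppose \<open>x\<close> and \<open>y\<close> are different neighbours of \<open>n\<close>. If the
  increasing path from the root to \<open>y\<close> missed \<open>x\<close>, then prolonging it by \<open>n\<close> and \<open>x\<close> would give a path
  from the root that is not increasing. So \<open>x\<close> lies on it, whence \<open>x < y\<close>; by symmetry \<open>y < x\<close>.\<close>

lemma increasing_tree_edge_to_largest_unique:
  assumes T: "(r, E) \<in> increasing_trees n" and x: "{x, n} \<in> E" and y: "{y, n} \<in> E"
  shows "x = y"
proof (rule ccontr)
  assume "x \<noteq> y"
  have D: "is_tree {1..n} E" "r \<in> {1..n}" "\<forall>e\<in>E. e \<subseteq> {1..n} \<and> card e = 2"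
    using increasing_treesD[OF T] by auto
  have srt: "sorted_wrt (<) p" if "is_path {1..n} E p" "hd p = r" for p
    using T that by (auto simp: increasing_trees_def)
  have less: "x < y" if x: "{x, n} \<in> E" and y: "{y, n} \<in> E" and xy: "x \<noteq> y" for x y
  proof -
    have lt: "z < n" "z \<in> {1..n}" if "{z, n} \<in> E" for z
    proof -
      have "{z, n} \<subseteq> {1..n}" "card {z, n} = 2" using bspec[OF D(3) that] by blast+
      then show "z < n" "z \<in> {1..n}" by (cases "z = n"; simp)+
    qed
    note lt[OF x] lt[OF y]
    then obtain p where p: "is_path {1..n} E p" "hd p = r" "last p = y"
      using D unfolding is_tree_def by blast
    then have ne: "p \<noteq> []" by (auto simp: is_path_def)
    have le: "a < y" if "a \<in> set p" "a \<noteq> y" for a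
    proof -
      have "p = butlast p @ [y]" using append_butlast_last_id[OF ne] p(3) by metis
      then show ?thesis using srt[OF p(1,2)] that
        by (metis Un_iff empty_iff insert_iff list.set set_append sorted_wrt_append)
    qed
    have "x \<in> set p"
    proof (rule ccontr)
      assume "x \<notin> set p"
      moreover have "n \<notin> set p" using le[of n] \<open>y < n\<close> by auto
      ultimately have "is_path {1..n} E ((p @ [n]) @ [x])"
        unfolding is_path_snoc using p ne x y \<open>x < n\<close> \<open>x \<in> _\<close> by (auto simp: insert_commute)
      then have "sorted_wrt (<) ((p @ [n]) @ [x])" using p ne by (intro srt) auto
      then show False using \<open>x < n\<close> by (auto simp: sorted_wrt_append)
    qed
    with le xy show ?thesis by blast
  qed
  from less[OF x y \<open>x \<noteq> y\<close>] less[OF y x] \<open>x \<noteq> y\<close> show False by simp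
qed

lemma increasing_trees_root:
  assumes T: "(r, E) \<in> increasing_trees n"
  shows "r = 1"
proof -
  have D: "is_tree {1..n} E" "r \<in> {1..n}" using increasing_treesD[OF T] by auto
  then have "1 \<in> {1..n}" by auto
  with D obtain p where p: "is_path {1..n} E p" "hd p = r" "last p = 1"
    unfolding is_tree_def by blast
  then have "sorted_wrt (<) p" using T by (auto simp: increasing_trees_def)
  moreover have "1 \<in> set p" using p last_in_set[of p] by (auto simp: is_path_def)
  ultimately have "r \<le> 1" using p(2) by (cases p) auto
  with D show ?thesis by simp
qed

text \<open>A path from the root to the largest label provides its parent \<open>u\<close>. As \<open>{u, n + 1}\<close> is the only
  edge at \<open>n + 1\<close>, removing it undoes the attachment of a leaf.\<close>

lemma increasing_trees_Suc:
  assumes "n \<ge> 1"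
  shows "increasing_trees (Suc n) =
    (\<lambda>(T, u). attach_leaf (Suc n) T u) ` (increasing_trees n \<times> {1..n})"
proof
  show "(\<lambda>(T, u). attach_leaf (Suc n) T u) ` (increasing_trees n \<times> {1..n})
      \<subseteq> increasing_trees (Suc n)"
    using attach_leaf_increasing by auto
next
  show "increasing_trees (Suc n) \<subseteq>
    (\<lambda>(T, u). attach_leaf (Suc n) T u) ` (increasing_trees n \<times> {1..n})"
  proof
    fix T assume "T \<in> increasing_trees (Suc n)"
    then obtain r E' where T: "T = (r, E')" "(r, E') \<in> increasing_trees (Suc n)" by (cases T) auto
    have r: "r = 1" using increasing_trees_root T by blast
    let ?w = "Suc n" and ?V = "{1..n}"
    have D: "is_tree {1..?w} E'" "\<forall>e\<in>E'. e \<subseteq> {1..?w} \<and> card e = 2"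
      using increasing_treesD[OF T(2)] by auto
    have "1 \<in> {1..?w}" "?w \<in> {1..?w}" by auto
    with D(1) obtain p where p: "is_path {1..?w} E' p" "hd p = 1" "last p = ?w"
      unfolding is_tree_def by blast
    then have "p = butlast p @ [?w]" "butlast p \<noteq> []"
      using \<open>n \<ge> 1\<close> by (cases p rule: rev_cases; auto simp: is_path_def)+
    then have "is_path {1..?w} E' (butlast p @ [?w])" using p by simp
    then obtain u where uE: "{u, ?w} \<in> E'"
      using \<open>butlast p \<noteq> []\<close> by (auto simp: is_path_snoc)
    define E where "E = E' - {{u, ?w}}"
    have E': "E' = insert {u, ?w} E" using uE by (auto simp: E_def)
    have "{u, ?w} \<subseteq> {1..?w}" "card {u, ?w} = 2" using bspec[OF D(2) uE] by blast+
    then have u: "u \<in> ?V" by (cases "u = ?w"; simp)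
    have E: "\<forall>e\<in>E. e \<subseteq> ?V"
    proof
      fix e assume e: "e \<in> E"
      then have e': "e \<in> E'" "e \<noteq> {u, ?w}" by (auto simp: E_def)
      have "?w \<notin> e"
      proof
        assume "?w \<in> e"
        moreover have "card e = 2" using D(2) e' by blast
        ultimately obtain x where "e = {x, ?w}" by (auto simp: card_2_iff)
        then show False using increasing_tree_edge_to_largest_unique[OF T(2)] e' uE by metis
      qed
      moreover have "e \<subseteq> {1..?w}" using D e' by blast
      ultimately show "e \<subseteq> ?V" by (fastforce simp: le_Suc_eq)
    qed
    have w: "?w \<notin> ?V" by simp
    have "is_tree ?V E"
      using is_tree_remove_leaf[OF _ E w u] D(1) E' by (simp only: atLeastAtMost_Suc_insert)
    moreover have "sorted_wrt (<) p" if "is_path ?V E p" "hd p = 1" for p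
    proof -
      have "is_path {1..?w} E' p" using is_path_mono[OF that(1), of "{1..?w}" E'] E' by auto
      then show ?thesis using T(2) that r by (auto simp: increasing_trees_def)
    qed
    ultimately have "(r, E) \<in> increasing_trees n"
      using \<open>n \<ge> 1\<close> r by (auto simp: increasing_trees_def)
    moreover have "T = attach_leaf ?w (r, E) u" by (simp add: attach_leaf_def T E')
    ultimately show "T \<in> (\<lambda>(T, u). attach_leaf (Suc n) T u) ` (increasing_trees n \<times> {1..n})"
      using u by (intro image_eqI[of _ _ "((r, E), u)"]) auto
  qed
qed

text \<open>The edge at \<open>n + 1\<close> reveals \<open>u\<close>, and the other edges are those of the old tree.\<close>

lemma inj_on_attach_leaf:
  "inj_on (\<lambda>(T, u). attach_leaf (Suc n) T u) (increasing_trees n \<times> {1..n})"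
proof (rule inj_onI, clarify)
  fix r E u s F v
  assume E: "(r, E) \<in> increasing_trees n" and F: "(s, F) \<in> increasing_trees n"
    and uv: "u \<in> {1..n}" "v \<in> {1..n}"
    and eq: "attach_leaf (Suc n) (r, E) u = attach_leaf (Suc n) (s, F) v"
  have eq': "insert {u, Suc n} E = insert {v, Suc n} F" "r = s"
    using eq by (auto simp: attach_leaf_def)
  have w: "Suc n \<notin> e" if "e \<in> E \<union> F" for e
    using that increasing_treesD(3)[OF E] increasing_treesD(3)[OF F] by force
  have "{u, Suc n} \<in> insert {v, Suc n} F" using eq' by blast
  then have "u = v" using w by (auto simp: doubleton_eq_iff)
  moreover have "E = {e \<in> insert {u, Suc n} E. Suc n \<notin> e}" using w by auto
  then have "E = {e \<in> insert {v, Suc n} F. Suc n \<notin> e}" unfolding eq'(1) .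
  then have "E = F" using w by auto
  ultimately show "(r, E) = (s, F) \<and> u = v" using eq'(2) by blast
qed

lemma sum_increasing_trees_Suc:
  assumes "n \<ge> 1"
  shows "(\<Sum>T\<in>increasing_trees (Suc n). f T) =
    (\<Sum>T\<in>increasing_trees n. \<Sum>u=1..n. f (attach_leaf (Suc n) T u))"
  unfolding increasing_trees_Suc[OF assms] sum.reindex[OF inj_on_attach_leaf]
  by (simp add: sum.cartesian_product case_prod_unfold comp_def)

lemma finite_card_increasing_trees:
  "finite (increasing_trees (Suc m)) \<and> card (increasing_trees (Suc m)) = fact m"
proof (induction m)
  case 0
  then show ?case using increasing_trees_1 by simp
next
  case (Suc m)
  then show ?case
    using increasing_trees_Suc[of "Suc m"] card_image[OF inj_on_attach_leaf[of "Suc m"]]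
    by (simp add: card_cartesian_product mult.commute del: atLeastAtMost_iff)
qed

lemma finite_edges: "T \<in> increasing_trees n \<Longrightarrow> finite (snd T)"
  by (rule finite_subset[of _ "Pow {1..n}"]) (use increasing_treesD(3) in blast, simp)

lemma new_edge_fresh: "T \<in> increasing_trees n \<Longrightarrow> {u, Suc n} \<notin> snd T"
  using increasing_treesD(3) by fastforce

lemma card_edges: "T \<in> increasing_trees (Suc m) \<Longrightarrow> card (snd T) = m"
proof (induction m arbitrary: T)
  case 0
  then show ?case using increasing_trees_1 by simp
next
  case (Suc m)
  then obtain T' u where T': "T' \<in> increasing_trees (Suc m)" "T = attach_leaf (Suc (Suc m)) T' u"
    using increasing_trees_Suc[of "Suc m"] by auto
  then show ?case
    using Suc.IH[OF T'(1)] finite_edges[OF T'(1)] new_edge_fresh[OF T'(1)]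
    by (simp add: attach_leaf_def)
qed

section \<open>Counting vertices and edges by subtree size\<close>

definition subtree_size :: "nat \<Rightarrow> nat \<times> nat set set \<Rightarrow> nat \<Rightarrow> nat" where
  "subtree_size n T v = card (subtree_vertices {1..n} T v)"

lemma subtree_vertices_subset: "subtree_vertices V T v \<subseteq> V"
  by (auto simp: subtree_vertices_def split: prod.splits)

lemma subtree_size_attach_leaf:
  assumes T: "T \<in> increasing_trees n" and u: "u \<in> {1..n}" and v: "v \<in> {1..n}"
  shows "subtree_size (Suc n) (attach_leaf (Suc n) T u) v =
    subtree_size n T v + of_bool (u \<in> subtree_vertices {1..n} T v)"
proof -
  let ?D = "subtree_vertices {1..n} T v"
  have E: "\<forall>e\<in>snd T. e \<subseteq> {1..n}" using increasing_treesD(3)[OF T] by blast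
  have w: "Suc n \<notin> {1..n}" by simp
  have D: "finite ?D" "Suc n \<notin> ?D"
    using subtree_vertices_subset[of "{1..n}" T v] finite_subset by auto
  have "subtree_vertices {1..Suc n} (attach_leaf (Suc n) T u) v =
      ?D \<union> (if u \<in> ?D then {Suc n} else {})"
    using subtree_vertices_attach_leaf[OF E w u increasing_treesD(2)[OF T] v]
    unfolding attach_leaf_def atLeastAtMost_Suc_insert prod.collapse .
  with D show ?thesis by (simp add: subtree_size_def)
qed

lemma subtree_size_new_leaf:
  assumes T: "T \<in> increasing_trees n" and u: "u \<in> {1..n}"
  shows "subtree_size (Suc n) (attach_leaf (Suc n) T u) (Suc n) = 1"
proof -
  have w: "Suc n \<notin> {1..n}" by simp
  show ?thesis
    using subtree_vertices_new_leaf[OF increasing_treesD(1)[OF T] w u increasing_treesD(2)[OF T]]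
    unfolding attach_leaf_def atLeastAtMost_Suc_insert subtree_size_def by simp
qed

lemma self_in_subtree:
  assumes "T \<in> increasing_trees n" "v \<in> {1..n}"
  shows "v \<in> subtree_vertices {1..n} T v"
  using self_in_subtree_vertices[OF increasing_treesD(1,2)[OF assms(1)] assms(2)] by simp

lemma subtree_size_pos:
  assumes "T \<in> increasing_trees n" "v \<in> {1..n}"
  shows "subtree_size n T v > 0"
  using self_in_subtree[OF assms] finite_subset[OF subtree_vertices_subset, of "{1..n}" T v]
  by (auto simp: subtree_size_def card_gt_0_iff)

lemma Min_edge_in_vertices:
  assumes "T \<in> increasing_trees n" "e \<in> snd T"
  shows "Min e \<in> {1..n}"
proof -
  have e: "e \<subseteq> {1..n}" "card e = 2" using increasing_treesD(3)[OF assms(1)] assms(2) by auto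
  then have "Min e \<in> e" by (intro Min_in) (auto intro: card_ge_0_finite)
  with e show ?thesis by blast
qed

text \<open>The growth step seen from one vertex: \<open>D\<close> is its set of descendants, and the sum counts the
  attachment points \<open>u\<close> after which that set has \<open>j + 1\<close> elements. These are the \<open>n - (j + 1)\<close> points
  outside \<open>D\<close> if \<open>D\<close> had that size already, and the \<open>j\<close> points of \<open>D\<close> if it had size \<open>j\<close>.\<close>

lemma sum_growth_of_subset:
  fixes n j :: nat
  assumes "D \<subseteq> {1..n}"
  shows "(\<Sum>u=1..n. of_bool (card D + of_bool (u \<in> D) = Suc j) :: real) =
    (real n - real (Suc j)) * of_bool (card D = Suc j) + real j * of_bool (card D = j)"
proof -
  have fin: "finite D" using assms finite_subset by blast
  have le: "card D \<le> n" using card_mono[OF _ assms] by simp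
  have "(\<Sum>u=1..n. of_bool (card D + of_bool (u \<in> D) = Suc j) :: real) =
      (\<Sum>u\<in>{1..n} - D. of_bool (card D + of_bool (u \<in> D) = Suc j)) +
      (\<Sum>u\<in>D. of_bool (card D + of_bool (u \<in> D) = Suc j))"
    by (rule sum.subset_diff[OF assms]) simp
  also have "(\<Sum>u\<in>{1..n} - D. of_bool (card D + of_bool (u \<in> D) = Suc j) :: real) =
      (real n - real (card D)) * of_bool (card D = Suc j)"
    using card_Diff_subset[OF fin assms] le by (simp add: of_nat_diff)
  also have "(\<Sum>u\<in>D. of_bool (card D + of_bool (u \<in> D) = Suc j) :: real) =
      real (card D) * of_bool (card D = j)"
    by simp
  finally show ?thesis by auto
qed

text \<open>The family \<open>f\<close> allows the same computation to serve for vertices (\<open>f\<close> is the identity) and for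
  edges (\<open>f\<close> is \<open>Min\<close>, the parent end).\<close>

lemma sum_subtree_size_attach_leaf:
  assumes T: "T \<in> increasing_trees n" and f: "\<And>x. x \<in> X \<Longrightarrow> f x \<in> {1..n}"
  shows "(\<Sum>u=1..n. \<Sum>x\<in>X.
      of_bool (subtree_size (Suc n) (attach_leaf (Suc n) T u) (f x) = Suc j) :: real) =
    (real n - real (Suc j)) * (\<Sum>x\<in>X. of_bool (subtree_size n T (f x) = Suc j)) +
    real j * (\<Sum>x\<in>X. of_bool (subtree_size n T (f x) = j))"
proof -
  have "(\<Sum>u=1..n. \<Sum>x\<in>X.
      of_bool (subtree_size (Suc n) (attach_leaf (Suc n) T u) (f x) = Suc j) :: real) =
    (\<Sum>x\<in>X. \<Sum>u=1..n.
      of_bool (subtree_size n T (f x) + of_bool (u \<in> subtree_vertices {1..n} T (f x)) = Suc j))"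
    by (subst sum.swap) (intro sum.cong refl, simp only: subtree_size_attach_leaf[OF T _ f])
  also have "\<dots> = (\<Sum>x\<in>X. (real n - real (Suc j)) * of_bool (subtree_size n T (f x) = Suc j) +
      real j * of_bool (subtree_size n T (f x) = j))"
    unfolding subtree_size_def
    by (intro sum.cong refl sum_growth_of_subset subtree_vertices_subset)
  finally show ?thesis by (simp add: sum.distrib sum_distrib_left)
qed

text \<open>The two counts are real-valued because their recurrences contain the coefficient \<open>n - (j + 1)\<close>,
  which is negative for \<open>j = n\<close>.\<close>

definition vertices_of_subtree_size :: "nat \<Rightarrow> nat \<Rightarrow> real" where
  "vertices_of_subtree_size n k =
     (\<Sum>T\<in>increasing_trees n. \<Sum>v=1..n. of_bool (subtree_size n T v = k))"

definition edges_of_subtree_size :: "nat \<Rightarrow> nat \<Rightarrow> real" where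
  "edges_of_subtree_size n k =
     (\<Sum>T\<in>increasing_trees n. \<Sum>e\<in>snd T. of_bool (subtree_size n T (Min e) = k))"

lemma vertices_of_subtree_size_0: "vertices_of_subtree_size n 0 = 0"
  using subtree_size_pos by (force simp: vertices_of_subtree_size_def intro!: sum.neutral)

lemma edges_of_subtree_size_0: "edges_of_subtree_size n 0 = 0"
  using subtree_size_pos Min_edge_in_vertices
  by (force simp: edges_of_subtree_size_def intro!: sum.neutral)

lemma vertices_of_subtree_size_Suc:
  "vertices_of_subtree_size (Suc (Suc m)) (Suc j) =
    (real (Suc m) - real (Suc j)) * vertices_of_subtree_size (Suc m) (Suc j) +
    real j * vertices_of_subtree_size (Suc m) j + fact (Suc m) * of_bool (j = 0)"
proof -
  let ?n = "Suc m"
  have "(\<Sum>u=1..?n. \<Sum>v=1..Suc ?n.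
        of_bool (subtree_size (Suc ?n) (attach_leaf (Suc ?n) T u) v = Suc j) :: real) =
      (real ?n - real (Suc j)) * (\<Sum>v=1..?n. of_bool (subtree_size ?n T v = Suc j)) +
      real j * (\<Sum>v=1..?n. of_bool (subtree_size ?n T v = j)) + real ?n * of_bool (j = 0)"
    if T: "T \<in> increasing_trees ?n" for T
  proof -
    have "(\<Sum>v=1..Suc ?n.
          of_bool (subtree_size (Suc ?n) (attach_leaf (Suc ?n) T u) v = Suc j) :: real) =
        (\<Sum>v=1..?n. of_bool (subtree_size (Suc ?n) (attach_leaf (Suc ?n) T u) v = Suc j)) +
        of_bool (j = 0)" if "u \<in> {1..?n}" for u
      using subtree_size_new_leaf[OF T that] by (simp add: sum.nat_ivl_Suc')
    then show ?thesis
      using sum_subtree_size_attach_leaf[OF T, of "{1..?n}" "\<lambda>v. v" j]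
      by (simp add: sum.distrib del: sum.cl_ivl_Suc)
  qed
  then show ?thesis
    using finite_card_increasing_trees[of m]
    by (simp add: vertices_of_subtree_size_def sum_increasing_trees_Suc sum.distrib
        sum_distrib_left mult.commute del: sum.cl_ivl_Suc)
qed

lemma edges_of_subtree_size_Suc:
  "edges_of_subtree_size (Suc (Suc m)) (Suc j) =
    (real (Suc m) - real (Suc j)) * edges_of_subtree_size (Suc m) (Suc j) +
    real j * edges_of_subtree_size (Suc m) j + vertices_of_subtree_size (Suc m) j"
proof -
  let ?n = "Suc m"
  have "(\<Sum>u=1..?n. \<Sum>e\<in>snd (attach_leaf (Suc ?n) T u).
        of_bool (subtree_size (Suc ?n) (attach_leaf (Suc ?n) T u) (Min e) = Suc j) :: real) =
      (real ?n - real (Suc j)) * (\<Sum>e\<in>snd T. of_bool (subtree_size ?n T (Min e) = Suc j)) +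
      real j * (\<Sum>e\<in>snd T. of_bool (subtree_size ?n T (Min e) = j)) +
      (\<Sum>v=1..?n. of_bool (subtree_size ?n T v = j))"
    if T: "T \<in> increasing_trees ?n" for T
  proof -
    have "(\<Sum>e\<in>snd (attach_leaf (Suc ?n) T u).
          of_bool (subtree_size (Suc ?n) (attach_leaf (Suc ?n) T u) (Min e) = Suc j) :: real) =
        (\<Sum>e\<in>snd T.
          of_bool (subtree_size (Suc ?n) (attach_leaf (Suc ?n) T u) (Min e) = Suc j)) +
        of_bool (subtree_size ?n T u = j)" if u: "u \<in> {1..?n}" for u
    proof -
      have "Min {u, Suc ?n} = u" using u by simp
      moreover have "subtree_size (Suc ?n) (attach_leaf (Suc ?n) T u) u = Suc (subtree_size ?n T u)"
        using subtree_size_attach_leaf[OF T u u] self_in_subtree[OF T u] by simp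
      moreover have "snd (attach_leaf (Suc ?n) T u) = insert {u, Suc ?n} (snd T)"
        by (simp add: attach_leaf_def)
      ultimately show ?thesis using finite_edges[OF T] new_edge_fresh[OF T, of u]
        by (simp add: add.commute)
    qed
    then show ?thesis
      using sum_subtree_size_attach_leaf[OF T, of "snd T" Min j] Min_edge_in_vertices[OF T]
      by (simp add: sum.distrib del: sum.cl_ivl_Suc)
  qed
  then show ?thesis
    by (simp add: edges_of_subtree_size_def vertices_of_subtree_size_def sum_increasing_trees_Suc
        sum.distrib sum_distrib_left del: sum.cl_ivl_Suc)
qed

lemma vertices_of_subtree_size_1: "vertices_of_subtree_size 1 k = of_bool (k = 1)"
proof -
  have T: "(1, {}) \<in> increasing_trees 1" using increasing_trees_1 by blast
  have "1 \<in> subtree_vertices {1..1} (1::nat, {}) 1" by (rule self_in_subtree[OF T]) simp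
  moreover have "subtree_vertices {1..1} (1::nat, {}) 1 \<subseteq> {1}"
    using subtree_vertices_subset[of "{1..1::nat}" "(1, {})" 1] by simp
  ultimately have "subtree_vertices {1..1} (1::nat, {}) 1 = {1}" by blast
  then have "subtree_size 1 (1, {}) 1 = 1" by (simp add: subtree_size_def)
  then show ?thesis unfolding vertices_of_subtree_size_def increasing_trees_1 by auto
qed

lemma edges_of_subtree_size_1: "edges_of_subtree_size 1 k = 0"
  unfolding edges_of_subtree_size_def increasing_trees_1 by simp

text \<open>At \<open>k = 0\<close> the quotient is a division by zero, which has the value \<open>0\<close> required there.\<close>

lemma vertices_of_subtree_size_eq:
  "vertices_of_subtree_size (Suc m) k = fact m *
    (if k = Suc m then 1 else if k < Suc m then real (Suc m) / (real k * (real k + 1)) else 0)"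
proof (induction m arbitrary: k)
  case 0
  then show ?case using vertices_of_subtree_size_1[of k] by auto
next
  case (Suc m)
  show ?case
  proof (cases k)
    case 0
    then show ?thesis by (simp add: vertices_of_subtree_size_0)
  next
    case k: (Suc j)
    consider "j = 0" | "0 < j" "j \<le> m" | "j = Suc m" | "j > Suc m" by linarith
    then show ?thesis
    proof cases
      case 2
      have coeff: "(x - y) * ((x + 1) / ((y + 1) * (y + 2))) + y * ((x + 1) / (y * (y + 1))) =
          (x + 1) * ((x + 2) / ((y + 1) * (y + 2)))" if "y > 0" for x y :: real
        using that by (simp add: divide_simps) algebra
      \<comment> \<open>For \<open>j = m\<close> the value at \<open>Suc j\<close> does not follow the generic formula, but its coefficient
        vanishes, so that this case needs no separate treatment.\<close>
      have "(real m - real j) * vertices_of_subtree_size (Suc m) (Suc j) = fact m *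
          ((real m - real j) * ((real m + 1) / ((real j + 1) * (real j + 2))))"
        using 2 by (auto simp: Suc.IH add.commute)
      moreover have "real j * vertices_of_subtree_size (Suc m) j = fact m *
          (real j * ((real m + 1) / (real j * (real j + 1))))"
        using 2 by (simp add: Suc.IH add.commute)
      moreover have "vertices_of_subtree_size (Suc (Suc m)) (Suc j) =
          (real m - real j) * vertices_of_subtree_size (Suc m) (Suc j) +
          real j * vertices_of_subtree_size (Suc m) j"
        using 2 by (simp add: vertices_of_subtree_size_Suc)
      ultimately have "vertices_of_subtree_size (Suc (Suc m)) (Suc j) = fact m *
          ((real m + 1) * ((real m + 2) / ((real j + 1) * (real j + 2))))"
        using 2 by (simp only: distrib_left[symmetric] coeff of_nat_0_less_iff)
      then show ?thesis using 2 by (simp add: k add.commute mult.commute mult.left_commute)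
    qed (simp_all add: k vertices_of_subtree_size_Suc Suc.IH field_simps)
  qed
qed

text \<open>In the recurrence the new edges contribute \<open>n / (j (j + 1))\<close>, and this is exactly what turns the
  \<open>H\<^sub>j\<^sub>-\<^sub>1\<close> coming from \<open>S\<^sub>n(j)\<close> into \<open>H\<^sub>j\<close>; this is where the harmonic numbers come from.\<close>

lemma edges_of_subtree_size_eq:
  "edges_of_subtree_size (Suc m) k = fact m *
    (if k = Suc m then harm m
     else if k < Suc m then real (Suc m) * harm (k - 1) / (real k * (real k + 1)) else 0)"
proof (induction m arbitrary: k)
  case 0
  then show ?case using edges_of_subtree_size_1[of k] by (simp add: harm_def)
next
  case (Suc m)
  show ?case
  proof (cases k)
    case 0
    then show ?thesis by (simp add: edges_of_subtree_size_0)
  next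
    case k: (Suc j)
    have harm: "harm j = harm (j - 1) + 1 / real j" if "j > 0"
      using that harm_Suc[of "j - 1", where ?'a = real] by (simp add: inverse_eq_divide)
    consider "j = 0" | "0 < j" "j \<le> m" | "j = Suc m" | "j > Suc m" by linarith
    then show ?thesis
    proof cases
      case 2
      have coeff: "(x - y) * ((x + 1) * (g + 1 / y) / ((y + 1) * (y + 2))) +
          y * ((x + 1) * g / (y * (y + 1))) + (x + 1) / (y * (y + 1)) =
          (x + 1) * ((x + 2) * (g + 1 / y) / ((y + 1) * (y + 2)))" if "y > 0" for x y g :: real
        using that by (simp add: divide_simps) algebra
      \<comment> \<open>Again the coefficient vanishes for \<open>j = m\<close>, where the generic formula fails.\<close>
      have "(real m - real j) * edges_of_subtree_size (Suc m) (Suc j) = fact m *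
          ((real m - real j) * ((real m + 1) * harm j / ((real j + 1) * (real j + 2))))"
        using 2 by (auto simp: Suc.IH add.commute)
      moreover have "real j * edges_of_subtree_size (Suc m) j = fact m *
          (real j * ((real m + 1) * harm (j - 1) / (real j * (real j + 1))))"
        using 2 by (simp add: Suc.IH add.commute)
      moreover have "vertices_of_subtree_size (Suc m) j = fact m *
          ((real m + 1) / (real j * (real j + 1)))"
        using 2 by (simp add: vertices_of_subtree_size_eq add.commute)
      moreover have "edges_of_subtree_size (Suc (Suc m)) (Suc j) =
          (real m - real j) * edges_of_subtree_size (Suc m) (Suc j) +
          real j * edges_of_subtree_size (Suc m) j + vertices_of_subtree_size (Suc m) j"
        by (simp add: edges_of_subtree_size_Suc)
      ultimately have "edges_of_subtree_size (Suc (Suc m)) (Suc j) = fact m *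
          ((real m + 1) * ((real m + 2) * harm j / ((real j + 1) * (real j + 2))))"
        using 2 by (simp only: distrib_left[symmetric] harm coeff of_nat_0_less_iff)
      then show ?thesis using 2 by (simp add: k add.commute mult.commute mult.left_commute)
    qed (simp_all add: k edges_of_subtree_size_Suc vertices_of_subtree_size_eq Suc.IH
        harm_Suc harm_expand field_simps)
  qed
qed

section \<open>The law of the removed subtree\<close>

lemma prob_bind_pmf_of_set:
  assumes "A \<noteq> {}" "finite A"
  shows "measure_pmf.prob (pmf_of_set A \<bind> f) S = (\<Sum>x\<in>A. measure_pmf.prob (f x) S) / card A"
proof -
  have "ennreal (measure_pmf.prob (pmf_of_set A \<bind> f) S) =
      (\<integral>\<^sup>+x. ennreal (measure_pmf.prob (f x) S) \<partial>measure_pmf (pmf_of_set A))"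
    by (simp add: measure_pmf.emeasure_eq_measure[symmetric])
  also have "\<dots> = ennreal (\<integral>x. measure_pmf.prob (f x) S \<partial>measure_pmf (pmf_of_set A))"
    by (intro nn_integral_eq_integral measure_pmf.integrable_const_bound[where B = 1]) auto
  finally show ?thesis
    using assms by (simp add: integral_pmf_of_set sum_nonneg divide_nonneg_nonneg)
qed

text \<open>All trees have the same number of edges, so averaging over the edges of each tree and then over
  the trees is one average over all pairs.\<close>

lemma prob_removed_subtree_size:
  assumes "n \<ge> 2"
  shows "measure_pmf.prob (random_tree_and_edge n) {\<omega>. removed_subtree_size n \<omega> = k} =
    edges_of_subtree_size n k / ((real n - 1) * fact (n - 1))"
proof -
  obtain m where n: "n = Suc m" and m: "m > 0" using assms by (cases n) auto
  let ?S = "{\<omega>. removed_subtree_size n \<omega> = k}"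
  have IT: "finite (increasing_trees n)" "card (increasing_trees n) = fact m"
    using finite_card_increasing_trees[of m] by (auto simp: n)
  then have ne: "increasing_trees n \<noteq> {}" by auto
  have "measure_pmf.prob (pmf_of_set (snd T) \<bind> (\<lambda>e. return_pmf (T, e))) ?S =
      (\<Sum>e\<in>snd T. of_bool (subtree_size n T (Min e) = k)) / real m"
    if T: "T \<in> increasing_trees n" for T
  proof -
    have E: "finite (snd T)" "card (snd T) = m" using finite_edges card_edges T n by auto
    then have "snd T \<noteq> {}" using m by auto
    with E show ?thesis
      by (simp add: prob_bind_pmf_of_set indicator_def removed_subtree_size_def subtree_size_def
          of_bool_def)
  qed
  then have "measure_pmf.prob (random_tree_and_edge n) ?S =
      (\<Sum>T\<in>increasing_trees n.
        (\<Sum>e\<in>snd T. of_bool (subtree_size n T (Min e) = k)) / real m) / fact m"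
    unfolding random_tree_and_edge_def random_recursive_tree_def
    by (simp add: prob_bind_pmf_of_set[OF ne IT(1)] IT(2))
  then show ?thesis
    by (simp add: edges_of_subtree_size_def sum_divide_distrib[symmetric] n)
qed

theorem proposition1p3:
  fixes n k :: nat
  assumes "n \<ge> 2" and "k \<ge> 1"
  shows "measure_pmf.prob (random_tree_and_edge n) {\<omega>. removed_subtree_size n \<omega> = k} =
    real n * harm (k - 1) / ((real n - 1) * (real k + 1) * real k) * of_bool (2 \<le> k \<and> k < n)
    + harm (n - 1) / (real n - 1) * of_bool (k = n)"
proof -
  obtain m where n: "n = Suc m" and m: "m > 0" using assms by (cases n) auto
  \<comment> \<open>For \<open>k = 1\<close> the count \<open>S\<^sub>n(1)\<close> vanishes because \<open>harm 0 = 0\<close>, in agreement with the indicator.\<close>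
  consider "k = n" | "k = 1" "k < n" | "2 \<le> k" "k < n" | "k > n" using assms by linarith
  then show ?thesis
    unfolding prob_removed_subtree_size[OF assms(1)]
    unfolding n edges_of_subtree_size_eq
    using m by cases (simp_all add: harm_expand mult_ac)
qed

end
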